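(* Let $M$ be a closed manifold with a compatible metric $d$, let $f\colon M\to M$ be a homeomorphism and let $N\ge1$. If $f$ is $N$-expansive and has the $\mathcal T_0$-continuous shadowing property, then $f$ is topologically hyperbolic, i.e. $f$ is expansive and has the shadowing property.
   Context: $\tilde M=M^{\mathbb Z}$ has the product topology. For $\delta\ge0$, $\tilde M(f,\delta)=\{x\in\tilde M: d(x_{i+1},f(x_i))\le\delta\ \forall i\in\mathbb Z\}$; its elements are called $\delta$-orbits. A $\delta$-orbit $x$ is $\epsilon$-shadowed by $p\in M$ if $d(f^i(p),x_i)\le\epsilon$ for all $i\in\mathbb Z$. $f$ has the shadowing property if for all $\epsilon>0$ there is $\delta>0$ such that every $\delta$-orbit is $\epsilon$-shadowed by some point. $f$ is $\mathcal T_0$-continuous shadowing if for all $\epsilon>0$ there are $\delta>0$ and a continuous map $R_\epsilon\colon\tilde M(f,\delta)\to M$ such that every $\delta$-orbit $x$ is $\epsilon$-shadowed by $R_\epsilon(x)$ (it is not required that $R_\epsilon$ sends the orbit $(f^i(p))_{i\in\mathbb Z}$ to $p$). $f$ is $N$-expansive if there is $\xi>0$ such that for every $p\in M$ the set $\Gamma_\xi(p)=\{q\in M: d(f^i(p),f^i(q))\le\xi\ \forall i\in\mathbb Z\}$ has at most $N$ points. $f$ is expansive if there is $\xi>0$ such that $p\ne q$ implies $d(f^i(p),f^i(q))>\xi$ for some $i\in\mathbb Z$. *)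

theory Defs
  imports "HOL-Analysis.Analysis"
begin

text \<open>Locally homeomorphic to Euclidean space of a fixed dimension (in particular no boundary).
  Connectedness is not required, and \<^term>\<open>n = 0\<close> is allowed.\<close>

definition closed_manifold_of_dim :: "nat \<Rightarrow> 'a topology \<Rightarrow> bool" where
  "closed_manifold_of_dim n X \<longleftrightarrow>
     compact_space X \<and> Hausdorff_space X \<and> second_countable X \<and>
     (\<forall>x\<in>topspace X. \<exists>U V. openin X U \<and> x \<in> U \<and> openin (Euclidean_space n) V \<and>
        subtopology X U homeomorphic_space subtopology (Euclidean_space n) V)"

definition closed_manifold :: "'a topology \<Rightarrow> bool" where
  "closed_manifold X \<longleftrightarrow> (\<exists>n. closed_manifold_of_dim n X)"

text \<open>The \<^term>\<open>i\<close>-th iterate, for integer \<^term>\<open>i\<close>, of a bijection \<^term>\<open>f\<close> of \<^term>\<open>M\<close>;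
  the inverse is taken relative to \<^term>\<open>M\<close>, as \<^term>\<open>f\<close> is arbitrary outside of it.\<close>

definition iter :: "'a set \<Rightarrow> ('a \<Rightarrow> 'a) \<Rightarrow> int \<Rightarrow> 'a \<Rightarrow> 'a" where
  "iter M f i = (if 0 \<le> i then f ^^ nat i else inv_into M f ^^ nat (- i))"

definition delta_orbits ::
    "'a set \<Rightarrow> ('a \<Rightarrow> 'a \<Rightarrow> real) \<Rightarrow> ('a \<Rightarrow> 'a) \<Rightarrow> real \<Rightarrow> (int \<Rightarrow> 'a) set" where
  "delta_orbits M d f \<delta> = {x. (\<forall>i. x i \<in> M) \<and> (\<forall>i. d (x (i + 1)) (f (x i)) \<le> \<delta>)}"

definition shadowed_by ::
    "'a set \<Rightarrow> ('a \<Rightarrow> 'a \<Rightarrow> real) \<Rightarrow> ('a \<Rightarrow> 'a) \<Rightarrow> real \<Rightarrow> (int \<Rightarrow> 'a) \<Rightarrow> 'a \<Rightarrow> bool" where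
  "shadowed_by M d f \<epsilon> x p \<longleftrightarrow> p \<in> M \<and> (\<forall>i. d (iter M f i p) (x i) \<le> \<epsilon>)"

definition has_shadowing :: "'a set \<Rightarrow> ('a \<Rightarrow> 'a \<Rightarrow> real) \<Rightarrow> ('a \<Rightarrow> 'a) \<Rightarrow> bool" where
  "has_shadowing M d f \<longleftrightarrow>
     (\<forall>\<epsilon>>0. \<exists>\<delta>>0. \<forall>x\<in>delta_orbits M d f \<delta>. \<exists>p. shadowed_by M d f \<epsilon> x p)"

definition T0_continuous_shadowing ::
    "'a topology \<Rightarrow> ('a \<Rightarrow> 'a \<Rightarrow> real) \<Rightarrow> ('a \<Rightarrow> 'a) \<Rightarrow> bool" where
  "T0_continuous_shadowing X d f \<longleftrightarrow>
     (\<forall>\<epsilon>>0. \<exists>\<delta>>0. \<exists>R.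
        continuous_map
          (subtopology (product_topology (\<lambda>_::int. X) UNIV) (delta_orbits (topspace X) d f \<delta>)) X R \<and>
        (\<forall>x\<in>delta_orbits (topspace X) d f \<delta>. shadowed_by (topspace X) d f \<epsilon> x (R x)))"

definition dyn_ball ::
    "'a set \<Rightarrow> ('a \<Rightarrow> 'a \<Rightarrow> real) \<Rightarrow> ('a \<Rightarrow> 'a) \<Rightarrow> real \<Rightarrow> 'a \<Rightarrow> 'a set" where
  "dyn_ball M d f \<xi> p = {q \<in> M. \<forall>i. d (iter M f i p) (iter M f i q) \<le> \<xi>}"

definition N_expansive :: "nat \<Rightarrow> 'a set \<Rightarrow> ('a \<Rightarrow> 'a \<Rightarrow> real) \<Rightarrow> ('a \<Rightarrow> 'a) \<Rightarrow> bool" where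
  "N_expansive N M d f \<longleftrightarrow>
     (\<exists>\<xi>>0. \<forall>p\<in>M. finite (dyn_ball M d f \<xi> p) \<and> card (dyn_ball M d f \<xi> p) \<le> N)"

definition expansive :: "'a set \<Rightarrow> ('a \<Rightarrow> 'a \<Rightarrow> real) \<Rightarrow> ('a \<Rightarrow> 'a) \<Rightarrow> bool" where
  "expansive M d f \<longleftrightarrow>
     (\<exists>\<xi>>0. \<forall>p\<in>M. \<forall>q\<in>M. p \<noteq> q \<longrightarrow> (\<exists>i. d (iter M f i p) (iter M f i q) > \<xi>))"

definition topologically_hyperbolic ::
    "'a set \<Rightarrow> ('a \<Rightarrow> 'a \<Rightarrow> real) \<Rightarrow> ('a \<Rightarrow> 'a) \<Rightarrow> bool" where
  "topologically_hyperbolic M d f \<longleftrightarrow> expansive M d f \<and> has_shadowing M d f"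

end

theory Submission
  imports Defs
begin

text \<open>
  The shadowing property is part of the hypothesis, so the theorem is about expansiveness. It is
  obtained by lowering the bound \<open>N\<close> one unit at a time, down to \<open>1\<close>-expansiveness
  (\<open>N_expansive_Suc_imp_N_expansive\<close>), and the reason is a tension between two properties
  of the map \<open>h\<close> that sends a point to the point \<open>R\<close> assigns to its orbit.

  On the one hand \<open>h\<close> is continuous and uniformly close to the identity, and on a closed
  manifold this forces it to be onto (\<open>near_identity_surjective\<close>). This is Brouwer's theorem
  read in a chart: a map of a cube that moves every point by at most half the side length
  covers the centre. Since the dimension \<open>n\<close> is a number and not a type, the needed form is derived
  from Kuhn's combinatorial lemma on cubes of functions \<open>nat \<Rightarrow> real\<close>
  (\<open>poincare_miranda\<close>).

  On the other hand \<open>h\<close> identifies points whose orbits stay very close to each other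
  (\<open>T0_shadowing_collapse\<close>). Indeed, two close points of a manifold lie in a small connected
  set. If the orbits of \<open>p\<close> and \<open>q\<close> stay close, choose such a set at every time; the product
  of these sets is a connected set of pseudo-orbits containing both orbits. Its image under
  \<open>R\<close> is connected and consists of points whose orbits stay near that of \<open>p\<close>, of which there are
  only finitely many. So \<open>R\<close> is constant on the product.

  Now write \<open>\<Gamma>\<^sub>a p\<close> for the dynamical ball of radius \<open>a\<close> around \<open>p\<close>, let \<open>h\<close> move points within
  their dynamical balls of radius \<open>\<epsilon>\<close>, and let \<open>h\<close> identify the points of each \<open>\<Gamma>\<^sub>\<eta> p\<close>. Preimages
  under \<open>h\<close> of points of \<open>\<Gamma>\<^sub>\<epsilon> p\<close> exist and lie in \<open>\<Gamma>\<^sub>2\<^sub>\<epsilon> p\<close>. If \<open>\<Gamma>\<^sub>2\<^sub>\<epsilon> p\<close> is contained in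
  \<open>\<Gamma>\<^sub>\<eta> p\<close>, all these preimages have the same image, and \<open>\<Gamma>\<^sub>\<epsilon> p\<close> is a single point (\<open>T0_shadowing_isolates\<close>). Otherwise
  shrinking the radius from \<open>2\<epsilon>\<close> to \<open>\<eta>\<close> loses a point. Either way, a bound of \<open>N + 1\<close> on the
  number of points becomes a bound of \<open>N\<close> at a smaller radius.
\<close>

section \<open>A Poincare--Miranda theorem in dimension \<open>n\<close>\<close>

text \<open>Points of the Euclidean space of dimension \<open>n\<close> are sequences that vanish from index \<open>n\<close> on,
  whence the second conjunct.\<close>

definition cube :: "nat \<Rightarrow> (nat \<Rightarrow> real) \<Rightarrow> real \<Rightarrow> (nat \<Rightarrow> real) set" where
  "cube n c r = {x. (\<forall>i<n. \<bar>x i - c i\<bar> \<le> r) \<and> (\<forall>i\<ge>n. x i = 0)}"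

lemma tendsto_fun_iff:
  fixes x :: "'b \<Rightarrow> nat \<Rightarrow> real"
  shows "(x \<longlongrightarrow> l) F \<longleftrightarrow> (\<forall>i. ((\<lambda>k. x k i) \<longlongrightarrow> l i) F)"
  using limitin_componentwise[of "\<lambda>_::nat. euclideanreal" UNIV x l F]
  by (simp add: euclidean_product_topology)

lemma compact_cube: "compact (cube n c r)"
proof -
  have "cube n c r = PiE UNIV (\<lambda>i. if i < n then cbox (c i - r) (c i + r) else {0})"
    unfolding cube_def by (auto simp: PiE_def Pi_def abs_le_iff not_less algebra_simps split: if_splits)
  moreover have "compactin (product_topology (\<lambda>_::nat. euclideanreal) UNIV) \<dots>"
    unfolding compactin_PiE by auto
  ultimately show ?thesis
    by (simp add: euclidean_product_topology)
qed

lemma cube_subset_open: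
  assumes "open T" "v \<in> T" "\<forall>i\<ge>n. v i = 0"
  shows "\<exists>r>0. cube n v r \<subseteq> T"
proof (rule ccontr)
  assume "\<not> ?thesis"
  then have "\<forall>k. \<exists>x. x \<in> cube n v (1 / real (Suc k)) \<and> x \<notin> T"
    by (metis subsetI of_nat_0_less_iff zero_less_Suc zero_less_divide_1_iff)
  then obtain x where x: "\<And>k. x k \<in> cube n v (1 / real (Suc k))" "\<And>k. x k \<notin> T"
    by metis
  have "x \<longlonglongrightarrow> v"
    unfolding tendsto_fun_iff
  proof
    fix i
    have "\<bar>x k i - v i\<bar> \<le> 1 / real (Suc k)" for k
      using x(1)[of k] assms(3) by (cases "i < n") (auto simp: cube_def)
    moreover have "(\<lambda>k. 1 / real (Suc k)) \<longlonglongrightarrow> 0"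
      using LIMSEQ_Suc lim_1_over_n by blast
    ultimately have "(\<lambda>k. x k i - v i) \<longlonglongrightarrow> 0"
      by (metis (no_types, lifting) Lim_null_comparison always_eventually real_norm_def)
    then show "(\<lambda>k. x k i) \<longlonglongrightarrow> v i"
      by (simp add: LIM_zero_iff)
  qed
  then have "eventually (\<lambda>k. x k \<in> T) sequentially"
    using assms topological_tendstoD by blast
  then show False
    using x(2) by simp
qed

text \<open>Subdivide the cube into \<open>(k + 1)\<^sup>n\<close> cells and label the grid points by the signs of the
  coordinates of \<open>F\<close>. The sign conditions on the faces are those of Kuhn's lemma, which yields a
  cell in which every coordinate of \<open>F\<close> takes a value \<open>\<le> 0\<close> and a value \<open>\<ge> 0\<close>. A limit of such cells is a common zero.\<close>

lemma poincare_miranda: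
  fixes F :: "(nat \<Rightarrow> real) \<Rightarrow> nat \<Rightarrow> real"
  assumes "0 < r"
    and cont: "\<And>i. i < n \<Longrightarrow> continuous_on (cube n c r) (\<lambda>x. F x i)"
    and lo: "\<And>x i. \<lbrakk>x \<in> cube n c r; i < n; x i = c i - r\<rbrakk> \<Longrightarrow> F x i \<le> 0"
    and hi: "\<And>x i. \<lbrakk>x \<in> cube n c r; i < n; x i = c i + r\<rbrakk> \<Longrightarrow> 0 \<le> F x i"
  shows "\<exists>x\<in>cube n c r. \<forall>i<n. F x i = 0"
proof -
  define g :: "nat \<Rightarrow> (nat \<Rightarrow> nat) \<Rightarrow> nat \<Rightarrow> real" where
    "g k q = (\<lambda>i. if i < n then c i - r + 2 * r * (real (q i) / real (Suc k)) else 0)" for k q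
  \<comment> \<open>The value on the faces is prescribed by position, as Kuhn's lemma requires; there \<open>F\<close> itself may
    vanish, so that its sign does not determine the label.\<close>
  define label :: "nat \<Rightarrow> (nat \<Rightarrow> nat) \<Rightarrow> nat \<Rightarrow> nat" where
    "label k q i = (if q i = Suc k \<or> q i \<noteq> 0 \<and> F (g k q) i > 0 then 1 else 0)" for k q i
  have g_cube: "g k q \<in> cube n c r" if "\<forall>i<n. q i \<le> Suc k" for k q
  proof -
    have "\<bar>2 * (r * real (q i)) / (1 + real k) - r\<bar> \<le> r" if "i < n" for i
    proof -
      have "0 \<le> real (q i) / (1 + real k)" "real (q i) / (1 + real k) \<le> 1"
        using \<open>\<forall>i<n. q i \<le> Suc k\<close> that by (auto simp: divide_simps of_nat_Suc[symmetric] simp del: of_nat_Suc)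
      then have "0 \<le> r * (real (q i) / (1 + real k))" "r * (real (q i) / (1 + real k)) \<le> r * 1"
        using \<open>0 < r\<close> by (simp, intro mult_left_mono, auto)
      then show ?thesis by (simp add: abs_le_iff)
    qed
    then show ?thesis by (auto simp: g_def cube_def algebra_simps)
  qed
  have label0: "F (g k q) i \<le> 0" if "\<forall>i<n. q i \<le> Suc k" "label k q i = 0" "i < n" for k q i
    using that lo[OF g_cube[OF that(1)] that(3)] by (auto simp: label_def g_def split: if_splits)
  have label1: "0 \<le> F (g k q) i" if "\<forall>i<n. q i \<le> Suc k" "label k q i \<noteq> 0" "i < n" for k q i
    using that hi[OF g_cube[OF that(1)] that(3)] by (auto simp: label_def g_def split: if_splits)
  have "\<exists>q. (\<forall>i<n. q i < Suc k) \<and> (\<forall>i<n. \<exists>a b.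
          (\<forall>j<n. q j \<le> a j \<and> a j \<le> q j + 1) \<and> (\<forall>j<n. q j \<le> b j \<and> b j \<le> q j + 1) \<and>
          F (g k a) i \<le> 0 \<and> 0 \<le> F (g k b) i)" for k
  proof -
    obtain q where q: "\<forall>i<n. q i < Suc k" and
      rs: "\<forall>i<n. \<exists>a b. (\<forall>j<n. q j \<le> a j \<and> a j \<le> q j + 1) \<and> (\<forall>j<n. q j \<le> b j \<and> b j \<le> q j + 1)
             \<and> label k a i \<noteq> label k b i"
      by (rule kuhn_lemma[of "Suc k" n "label k"]) (auto simp: label_def)
    have "\<exists>a b. (\<forall>j<n. q j \<le> a j \<and> a j \<le> q j + 1) \<and> (\<forall>j<n. q j \<le> b j \<and> b j \<le> q j + 1) \<and>
          F (g k a) i \<le> 0 \<and> 0 \<le> F (g k b) i" if i: "i < n" for i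
    proof -
      obtain a b where ab: "\<forall>j<n. q j \<le> a j \<and> a j \<le> q j + 1" "\<forall>j<n. q j \<le> b j \<and> b j \<le> q j + 1"
        "label k a i \<noteq> label k b i"
        using rs i by blast
      have le: "\<forall>j<n. a j \<le> Suc k" "\<forall>j<n. b j \<le> Suc k"
        using ab q by (metis Suc_eq_plus1 Suc_leI le_trans Suc_le_mono)+
      show ?thesis
      proof (cases "label k a i = 0")
        case True
        then show ?thesis using ab label0[OF le(1) _ i] label1[OF le(2) _ i] by metis
      next
        case False
        then have "label k b i = 0" using ab(3) by (auto simp: label_def split: if_splits)
        then show ?thesis using False ab label0[OF le(2) _ i] label1[OF le(1) _ i] by metis
      qed
    qed
    then show ?thesis using q by blast
  qed
  then obtain q where q: "\<And>k i. i < n \<Longrightarrow> q k i < Suc k"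
    and "\<forall>k. \<forall>i<n. \<exists>a b.
          (\<forall>j<n. q k j \<le> a j \<and> a j \<le> q k j + 1) \<and> (\<forall>j<n. q k j \<le> b j \<and> b j \<le> q k j + 1) \<and>
          F (g k a) i \<le> 0 \<and> 0 \<le> F (g k b) i"
    by metis
  then obtain a b where
    a: "\<And>k i j. \<lbrakk>i < n; j < n\<rbrakk> \<Longrightarrow> q k j \<le> a k i j \<and> a k i j \<le> q k j + 1" and
    b: "\<And>k i j. \<lbrakk>i < n; j < n\<rbrakk> \<Longrightarrow> q k j \<le> b k i j \<and> b k i j \<le> q k j + 1" and
    Fa: "\<And>k i. i < n \<Longrightarrow> F (g k (a k i)) i \<le> 0" and
    Fb: "\<And>k i. i < n \<Longrightarrow> 0 \<le> F (g k (b k i)) i"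
    by metis
  have "\<forall>k. g k (q k) \<in> cube n c r"
    using q by (intro allI g_cube) (simp add: less_imp_le)
  then obtain z \<sigma> where z: "z \<in> cube n c r" and \<sigma>: "strict_mono (\<sigma> :: nat \<Rightarrow> nat)"
    and lim: "((\<lambda>k. g k (q k)) \<circ> \<sigma>) \<longlonglongrightarrow> z"
    using compact_cube[of n c r] unfolding compact_eq_seq_compact_metric seq_compact_def by meson
  \<comment> \<open>The cells shrink, so a corner of the cell of \<open>q k\<close> has the same limit as \<open>q k\<close> itself.\<close>
  have corner: "(\<lambda>k. F (g (\<sigma> k) (u (\<sigma> k))) i) \<longlonglongrightarrow> F z i"
    if u: "\<And>k j. j < n \<Longrightarrow> q k j \<le> u k j \<and> u k j \<le> q k j + 1" and i: "i < n" for u i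
  proof -
    have "(\<lambda>k. g (\<sigma> k) (u (\<sigma> k))) \<longlonglongrightarrow> z"
      unfolding tendsto_fun_iff
    proof
      fix j
      have "\<bar>g k (u k) j - g k (q k) j\<bar> \<le> 2 * r * (1 / real (Suc k))" for k
      proof (cases "j < n")
        case True
        then have "\<bar>g k (u k) j - g k (q k) j\<bar> = 2 * r * ((real (u k j) - real (q k j)) / real (Suc k))"
          using u[OF True, of k] \<open>0 < r\<close> by (simp add: g_def diff_divide_distrib right_diff_distrib
            divide_right_mono mult_left_mono)
        also have "\<dots> \<le> 2 * r * (1 / real (Suc k))"
          using u[OF True, of k] \<open>0 < r\<close> by (intro mult_left_mono divide_right_mono) auto
        finally show ?thesis .
      qed (use \<open>0 < r\<close> in \<open>simp add: g_def\<close>)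
      moreover have "(\<lambda>k. 2 * r * (1 / real (Suc k))) \<longlonglongrightarrow> 0"
        using LIMSEQ_Suc[OF lim_1_over_n[where 'a=real]] tendsto_mult_right_zero by blast
      ultimately have "(\<lambda>k. g k (u k) j - g k (q k) j) \<longlonglongrightarrow> 0"
        by (metis (no_types, lifting) Lim_null_comparison always_eventually real_norm_def)
      from LIMSEQ_subseq_LIMSEQ[OF this \<sigma>]
      have "(\<lambda>k. g (\<sigma> k) (u (\<sigma> k)) j - g (\<sigma> k) (q (\<sigma> k)) j) \<longlonglongrightarrow> 0"
        by (simp add: o_def)
      moreover have "(\<lambda>k. g (\<sigma> k) (q (\<sigma> k)) j) \<longlonglongrightarrow> z j"
        using lim by (simp add: tendsto_fun_iff o_def)
      ultimately show "(\<lambda>k. g (\<sigma> k) (u (\<sigma> k)) j) \<longlonglongrightarrow> z j"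
        using tendsto_add by fastforce
    qed
    moreover have "\<forall>k. g k (u k) \<in> cube n c r"
    proof (intro allI g_cube impI)
      fix k j assume "j < n"
      then show "u k j \<le> Suc k" using u[of j k] q[of j k] by linarith
    qed
    ultimately show ?thesis
      using cont[OF i] z unfolding continuous_on_sequentially by (auto simp: o_def)
  qed
  have "F z i = 0" if i: "i < n" for i
  proof (rule antisym)
    show "F z i \<le> 0"
      using corner[of "\<lambda>k. a k i" i] a i Fa by (intro LIMSEQ_le_const2) auto
    show "0 \<le> F z i"
      using corner[of "\<lambda>k. b k i" i] b i Fb by (intro LIMSEQ_le_const) auto
  qed
  then show ?thesis using z by blast
qed

text \<open>On a face of the cube, a displacement of at most \<open>r\<close> cannot cross the hyperplane through
  the centre, so \<open>g - c\<close> has the signs that the previous theorem asks for.\<close>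

lemma near_identity_hits_centre:
  fixes g :: "(nat \<Rightarrow> real) \<Rightarrow> nat \<Rightarrow> real"
  assumes "0 < r"
    and cont: "continuous_on (cube n c r) g"
    and near: "\<And>y i. \<lbrakk>y \<in> cube n c r; i < n\<rbrakk> \<Longrightarrow> \<bar>g y i - y i\<bar> \<le> r"
  shows "\<exists>y\<in>cube n c r. \<forall>i<n. g y i = c i"
proof -
  have "\<exists>y\<in>cube n c r. \<forall>i<n. (\<lambda>i. g y i - c i) i = 0"
  proof (rule poincare_miranda[OF \<open>0 < r\<close>])
    show "continuous_on (cube n c r) (\<lambda>x. g x i - c i)" for i
      using cont by (intro continuous_intros) (rule continuous_on_product_then_coordinatewise)
    show "g x i - c i \<le> 0" if "x \<in> cube n c r" "i < n" "x i = c i - r" for x i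
      using near[OF that(1,2)] that(3) by linarith
    show "0 \<le> g x i - c i" if "x \<in> cube n c r" "i < n" "x i = c i + r" for x i
      using near[OF that(1,2)] that(3) by linarith
  qed
  then show ?thesis by simp
qed

section \<open>Maps of a closed manifold close to the identity are onto\<close>

lemma open_box: "open {y :: nat \<Rightarrow> real. \<forall>i<n. \<bar>y i - c i\<bar> < t}"
proof -
  have "open {y :: nat \<Rightarrow> real. \<bar>y i - c i\<bar> < t}" for i
    by (intro open_Collect_less continuous_intros continuous_on_product_coordinates)
  then have "open (\<Inter>i\<in>{..<n}. {y :: nat \<Rightarrow> real. \<bar>y i - c i\<bar> < t})"
    by blast
  moreover have "(\<Inter>i\<in>{..<n}. {y :: nat \<Rightarrow> real. \<bar>y i - c i\<bar> < t}) = {y. \<forall>i<n. \<bar>y i - c i\<bar> < t}"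
    by auto
  ultimately show ?thesis by simp
qed

context Metric_space
begin

text \<open>In a chart around \<open>x\<close>, keep a cube of half-side \<open>2r\<close>. Every \<open>q\<close> in the open cube of
  half-side \<open>r\<close> is the centre of a cube of half-side \<open>r\<close> inside it, and if \<open>h\<close> moves the points of the
  compact large cube by at most \<open>r\<close> in chart coordinates, then \<open>h\<close> takes the value \<open>q\<close>. One \<open>\<epsilon>\<close> serves
  all \<open>q\<close> of this neighbourhood, which is what makes the next lemma uniform.\<close>

lemma near_identity_covers_chart_nbhd:
  assumes U: "openin mtopology U" "x \<in> U"
    and V: "openin (Euclidean_space n) V"
    and hom: "homeomorphic_maps (subtopology mtopology U) (subtopology (Euclidean_space n) V) \<phi> \<psi>"
  shows "\<exists>W \<epsilon>. openin mtopology W \<and> x \<in> W \<and> \<epsilon> > 0 \<and>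
    (\<forall>h. continuous_map mtopology mtopology h \<and> (\<forall>y\<in>M. d y (h y) < \<epsilon>) \<longrightarrow> W \<subseteq> h ` M)"
proof -
  have UM: "U \<subseteq> M" using U openin_subset by fastforce
  have E: "Euclidean_space n = top_of_set {y. \<forall>i\<ge>n. y i = 0}"
    by (simp add: Euclidean_space_def euclidean_product_topology)
  obtain T where T: "open T" "V = {y. \<forall>i\<ge>n. y i = 0} \<inter> T"
    using V unfolding E openin_open by blast
  have subV: "subtopology (Euclidean_space n) V = top_of_set V"
    using T by (simp add: E subtopology_subtopology Int_absorb1)
  have topU: "topspace (subtopology mtopology U) = U" using UM by auto
  have \<phi>: "continuous_map (subtopology mtopology U) euclidean \<phi>" "\<And>y. y \<in> U \<Longrightarrow> \<phi> y \<in> V"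
    and \<psi>: "continuous_map (top_of_set V) mtopology \<psi>" "\<And>z. z \<in> V \<Longrightarrow> \<psi> z \<in> U"
    and \<psi>\<phi>: "\<And>y. y \<in> U \<Longrightarrow> \<psi> (\<phi> y) = y" and \<phi>\<psi>: "\<And>z. z \<in> V \<Longrightarrow> \<phi> (\<psi> z) = z"
    using hom UM unfolding homeomorphic_maps_def subV continuous_map_in_subtopology
    by (auto simp: Pi_iff)
  define P where "P c t = {y \<in> U. \<phi> y \<in> {z. \<forall>i<n. \<bar>z i - c i\<bar> < t}}" for c t
  have P: "openin mtopology (P c t)" for c t
  proof -
    have "openin (subtopology mtopology U) (P c t)"
      using openin_continuous_map_preimage[OF \<phi>(1) open_openin[THEN iffD1, OF open_box]]
      unfolding P_def topU .
    then show ?thesis using U(1) openin_trans_full by blast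
  qed
  obtain s where "s > 0" "cube n (\<phi> x) s \<subseteq> T"
    using cube_subset_open[of T "\<phi> x" n] T \<phi>(2)[OF U(2)] by auto
  define r where "r = s / 2"
  have "r > 0" and QV: "cube n (\<phi> x) (2 * r) \<subseteq> V"
    using \<open>s > 0\<close> \<open>cube n (\<phi> x) s \<subseteq> T\<close> T by (auto simp: r_def cube_def)
  let ?K = "\<psi> ` cube n (\<phi> x) (2 * r)"
  have "compactin (top_of_set V) (cube n (\<phi> x) (2 * r))"
    using compact_cube QV by (simp add: compactin_subtopology)
  then have K: "compactin mtopology ?K"
    using \<psi>(1) image_compactin by blast
  have KU: "?K \<subseteq> U" using QV \<psi>(2) by blast
  have "y \<in> P (\<phi> y) (r / 2)" if "y \<in> U" for y
    using that \<open>r > 0\<close> by (simp add: P_def)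
  then have "?K \<subseteq> \<Union> (range (\<lambda>c. P c (r / 2)))"
    using KU by blast
  \<comment> \<open>A Lebesgue number of the cover by sets of coordinate diameter at most \<open>r\<close> turns closeness in the
    metric into closeness in coordinates, and keeps \<open>h (\<psi> z)\<close> inside the chart.\<close>
  then have "\<exists>\<epsilon>>0. \<forall>y\<in>?K. \<exists>A \<in> range (\<lambda>c. P c (r / 2)). mball y \<epsilon> \<subseteq> A"
    by (rule lebesgue_number[OF K]) (use P in blast)
  then obtain \<epsilon> where "\<epsilon> > 0" and \<epsilon>: "\<And>y. y \<in> ?K \<Longrightarrow> \<exists>c. mball y \<epsilon> \<subseteq> P c (r / 2)"
    by auto
  have "q \<in> h ` M" if h: "continuous_map mtopology mtopology h" "\<And>y. y \<in> M \<Longrightarrow> d y (h y) < \<epsilon>"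
    and q: "q \<in> P (\<phi> x) r" for h q
  proof -
    let ?Q = "cube n (\<phi> q) r"
    have "q \<in> U" using q by (simp add: P_def)
    have Q: "?Q \<subseteq> cube n (\<phi> x) (2 * r)"
    proof
      fix z assume z: "z \<in> ?Q"
      have "\<bar>z i - \<phi> x i\<bar> \<le> 2 * r" if "i < n" for i
      proof -
        have "\<bar>z i - \<phi> q i\<bar> \<le> r" "\<bar>\<phi> q i - \<phi> x i\<bar> < r"
          using z q that by (auto simp: cube_def P_def)
        then show ?thesis by linarith
      qed
      then show "z \<in> cube n (\<phi> x) (2 * r)" using z by (simp add: cube_def)
    qed
    have small: "h (\<psi> z) \<in> U \<and> (\<forall>i<n. \<bar>\<phi> (h (\<psi> z)) i - z i\<bar> \<le> r)" if z: "z \<in> ?Q" for z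
    proof -
      have "\<psi> z \<in> ?K" "\<psi> z \<in> M" "z \<in> V" using z Q QV KU UM by auto
      obtain c where c: "mball (\<psi> z) \<epsilon> \<subseteq> P c (r / 2)"
        using \<epsilon>[OF \<open>\<psi> z \<in> ?K\<close>] by blast
      have "h (\<psi> z) \<in> M" using h(1) \<open>\<psi> z \<in> M\<close> by (auto simp: continuous_map_def)
      then have "h (\<psi> z) \<in> P c (r / 2)" "\<psi> z \<in> P c (r / 2)"
        using c h(2) \<open>\<psi> z \<in> M\<close> \<open>\<epsilon> > 0\<close> by (auto intro!: subsetD[OF c])
      moreover have "\<bar>a - b\<bar> \<le> r" if "\<bar>a - e\<bar> < r / 2" "\<bar>b - e\<bar> < r / 2" for a b e :: real
        using that by linarith
      ultimately show ?thesis
        using \<phi>\<psi>[OF \<open>z \<in> V\<close>] unfolding P_def by fastforce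
    qed
    have "continuous_on ?Q (\<lambda>z. \<phi> (h (\<psi> z)))"
    proof -
      have "continuous_map (top_of_set ?Q) mtopology \<psi>"
        using \<psi>(1) Q QV continuous_map_from_subtopology_mono by blast
      then have "continuous_map (top_of_set ?Q) mtopology (h \<circ> \<psi>)"
        using h(1) continuous_map_compose by blast
      then have "continuous_map (top_of_set ?Q) (subtopology mtopology U) (h \<circ> \<psi>)"
        using small by (intro continuous_map_into_subtopology) auto
      then have "continuous_map (top_of_set ?Q) euclidean (\<phi> \<circ> (h \<circ> \<psi>))"
        using \<phi>(1) continuous_map_compose by blast
      then show ?thesis by (simp add: o_def)
    qed
    from near_identity_hits_centre[OF \<open>r > 0\<close> this]
    obtain z where z: "z \<in> ?Q" "\<And>i. i < n \<Longrightarrow> \<phi> (h (\<psi> z)) i = \<phi> q i"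
      using small by blast
    have "h (\<psi> z) \<in> U" using small z(1) by blast
    have "\<phi> (h (\<psi> z)) = \<phi> q"
    proof
      fix i
      show "\<phi> (h (\<psi> z)) i = \<phi> q i"
        using z(2) \<phi>(2)[OF \<open>h (\<psi> z) \<in> U\<close>] \<phi>(2)[OF \<open>q \<in> U\<close>] T(2)
        by (cases "i < n") auto
    qed
    then have "h (\<psi> z) = q"
      using \<psi>\<phi> \<open>h (\<psi> z) \<in> U\<close> \<open>q \<in> U\<close> by metis
    then show ?thesis
      using z(1) Q KU UM by blast
  qed
  moreover have "x \<in> P (\<phi> x) r" using U(2) \<open>r > 0\<close> by (simp add: P_def)
  ultimately show ?thesis
    using P[of "\<phi> x" r] \<open>\<epsilon> > 0\<close> by (intro exI[of _ "P (\<phi> x) r"] exI[of _ \<epsilon>]) blast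
qed

lemma near_identity_surjective:
  assumes "closed_manifold mtopology"
  obtains \<epsilon> where "\<epsilon> > 0"
    "\<And>h. \<lbrakk>continuous_map mtopology mtopology h; \<And>y. y \<in> M \<Longrightarrow> d y (h y) < \<epsilon>\<rbrakk> \<Longrightarrow> M \<subseteq> h ` M"
proof -
  obtain n where n: "closed_manifold_of_dim n mtopology"
    using assms closed_manifold_def by blast
  have "\<exists>W \<epsilon>. openin mtopology W \<and> x \<in> W \<and> \<epsilon> > 0 \<and>
    (\<forall>h. continuous_map mtopology mtopology h \<and> (\<forall>y\<in>M. d y (h y) < \<epsilon>) \<longrightarrow> W \<subseteq> h ` M)"
    if "x \<in> M" for x
  proof -
    obtain U V where UV: "openin mtopology U" "x \<in> U" "openin (Euclidean_space n) V"
      and "subtopology mtopology U homeomorphic_space subtopology (Euclidean_space n) V"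
      using n \<open>x \<in> M\<close> unfolding closed_manifold_of_dim_def by auto
    then obtain \<phi> \<psi> where
      "homeomorphic_maps (subtopology mtopology U) (subtopology (Euclidean_space n) V) \<phi> \<psi>"
      unfolding homeomorphic_space_def by blast
    from near_identity_covers_chart_nbhd[OF UV this] show ?thesis .
  qed
  then obtain W \<epsilon> where W: "\<And>x. x \<in> M \<Longrightarrow> openin mtopology (W x)" "\<And>x. x \<in> M \<Longrightarrow> x \<in> W x"
    and \<epsilon>: "\<And>x. x \<in> M \<Longrightarrow> \<epsilon> x > 0"
    and cov: "\<And>x h. \<lbrakk>x \<in> M; continuous_map mtopology mtopology h; \<forall>y\<in>M. d y (h y) < \<epsilon> x\<rbrakk>
      \<Longrightarrow> W x \<subseteq> h ` M"
    by metis
  have "compactin mtopology M"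
    using n by (simp add: closed_manifold_of_dim_def compact_space_def)
  moreover have "M \<subseteq> \<Union> (W ` M)" using W(2) by blast
  ultimately obtain \<F> where "finite \<F>" "\<F> \<subseteq> W ` M" "M \<subseteq> \<Union> \<F>"
    unfolding compactin_def using W(1) by (metis (no_types, lifting) imageE)
  then obtain S where S: "S \<subseteq> M" "finite S" "M \<subseteq> \<Union> (W ` S)"
    using finite_subset_image[of \<F> W M] by blast
  define e where "e = Min (insert 1 (\<epsilon> ` S))"
  show thesis
  proof
    show "e > 0" using S \<epsilon> by (auto simp: e_def subset_iff)
    fix h assume h: "continuous_map mtopology mtopology h" "\<And>y. y \<in> M \<Longrightarrow> d y (h y) < e"
    have "W x \<subseteq> h ` M" if "x \<in> S" for x
    proof (rule cov)
      have "e \<le> \<epsilon> x" using S that by (simp add: e_def)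
      then show "\<forall>y\<in>M. d y (h y) < \<epsilon> x" using h(2) by fastforce
    qed (use S that h in auto)
    then show "M \<subseteq> h ` M" using S(3) by blast
  qed
qed

section \<open>Uniformity on compact metric spaces\<close>

text \<open>A Lebesgue number of the cover by small connected open sets.\<close>

lemma small_connected_sets_join_close_points:
  assumes "compact_space mtopology" "locally_connected_space mtopology" "0 < e"
  obtains \<eta> where "\<eta> > 0"
    "\<And>x y. \<lbrakk>x \<in> M; y \<in> M; d x y < \<eta>\<rbrakk> \<Longrightarrow>
      \<exists>C. connectedin mtopology C \<and> x \<in> C \<and> y \<in> C \<and> C \<subseteq> mball x e"
proof -
  define \<C> where "\<C> = {C. openin mtopology C \<and> connectedin mtopology C \<and> (\<exists>z\<in>M. C \<subseteq> mball z (e / 2))}"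
  have "x \<in> \<Union> \<C>" if "x \<in> M" for x
  proof -
    have "openin mtopology (mball x (e / 2))" "x \<in> mball x (e / 2)"
      using that \<open>0 < e\<close> by auto
    then obtain C where "openin mtopology C" "connectedin mtopology C" "x \<in> C" "C \<subseteq> mball x (e / 2)"
      using assms(2) unfolding locally_connected_space by meson
    then show ?thesis using that unfolding \<C>_def by blast
  qed
  then have "M \<subseteq> \<Union> \<C>" by blast
  then have "\<exists>\<eta>>0. \<forall>x\<in>M. \<exists>C\<in>\<C>. mball x \<eta> \<subseteq> C"
    using assms(1) by (intro lebesgue_number) (auto simp: compact_space_def \<C>_def)
  then obtain \<eta> where "\<eta> > 0" and \<eta>: "\<And>x. x \<in> M \<Longrightarrow> \<exists>C\<in>\<C>. mball x \<eta> \<subseteq> C"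
    by blast
  show thesis
  proof
    fix x y assume xy: "x \<in> M" "y \<in> M" "d x y < \<eta>"
    obtain C z where C: "connectedin mtopology C" "mball x \<eta> \<subseteq> C" "z \<in> M" "C \<subseteq> mball z (e / 2)"
      using \<eta>[OF xy(1)] unfolding \<C>_def by blast
    have "x \<in> C" "y \<in> C" using C(2) xy \<open>\<eta> > 0\<close> by auto
    moreover have "C \<subseteq> mball x e"
    proof
      fix w assume "w \<in> C"
      then have "w \<in> M" "d z w < e / 2" "d z x < e / 2" using C(4) \<open>x \<in> C\<close> by auto
      then show "w \<in> mball x e"
        using triangle[of x z w] commute[of x z] C(3) xy(1) by auto
    qed
    ultimately show "\<exists>C. connectedin mtopology C \<and> x \<in> C \<and> y \<in> C \<and> C \<subseteq> mball x e"
      using C(1) by blast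
  qed fact
qed

lemma compact_uniformly_continuous_self_map:
  assumes "compact_space mtopology" "continuous_map mtopology mtopology f" "0 < e"
  obtains \<eta> where "\<eta> > 0" "\<And>x y. \<lbrakk>x \<in> M; y \<in> M; d x y < \<eta>\<rbrakk> \<Longrightarrow> d (f x) (f y) < e"
proof -
  define m where "m = metric (M, d)"
  have m: "mspace m = M" "mdist m = d" "mtopology_of m = mtopology"
    by (simp_all add: m_def)
  have "uniformly_continuous_map m m f"
    using assms(1,2) by (intro continuous_imp_uniformly_continuous_map) (simp add: m)
  then obtain \<eta> where "\<eta> > 0" "\<forall>x\<in>M. \<forall>y\<in>M. d y x < \<eta> \<longrightarrow> d (f y) (f x) < e"
    using \<open>0 < e\<close> unfolding uniformly_continuous_map_def m by meson
  then show thesis using that by blast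
qed

end

lemma closed_manifold_locally_connected:
  assumes "closed_manifold X"
  shows "locally_connected_space X"
proof -
  obtain n where n: "closed_manifold_of_dim n X"
    using assms closed_manifold_def by blast
  show ?thesis
    unfolding locally_connected_space
  proof (intro allI impI, elim conjE)
    fix A x assume A: "openin X A" "x \<in> A"
    then have "x \<in> topspace X" using openin_subset by blast
    then obtain U V where U: "openin X U" "x \<in> U" and V: "openin (Euclidean_space n) V"
      and UV: "subtopology X U homeomorphic_space subtopology (Euclidean_space n) V"
      using n unfolding closed_manifold_of_dim_def by meson
    have "locally_connected_space (subtopology X U)"
      using homeomorphic_locally_connected_space[OF UV] V
      by (simp add: locally_connected_Euclidean_space locally_connected_space_open_subset)
    moreover have "openin (subtopology X U) (A \<inter> U)" "x \<in> A \<inter> U"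
      using A U by (auto simp: openin_subtopology_Int)
    ultimately obtain B where "openin (subtopology X U) B" "connectedin (subtopology X U) B" "x \<in> B" "B \<subseteq> A \<inter> U"
      unfolding locally_connected_space by meson
    then show "\<exists>B. openin X B \<and> connectedin X B \<and> x \<in> B \<and> B \<subseteq> A"
      using U(1) openin_trans_full by (metis connectedin_subtopology le_inf_iff)
  qed
qed

section \<open>Integer iterates and dynamical balls\<close>

lemma iter_0 [simp]: "iter M f 0 p = p"
  by (simp add: iter_def)

lemma continuous_map_funpow: "continuous_map X X g \<Longrightarrow> continuous_map X X (g ^^ k)"
proof (induction k)
  case (Suc k)
  then show ?case using continuous_map_compose[OF Suc.IH Suc.prems] by (simp add: o_def)
qed simp

lemma continuous_map_iter:
  assumes "homeomorphic_map X X f"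
  shows "continuous_map X X (iter (topspace X) f i)"
proof -
  obtain g where g: "homeomorphic_maps X X f g"
    using assms homeomorphic_map_maps by blast
  have "inv_into (topspace X) f y = g y" if "y \<in> topspace X" for y
    using g that homeomorphic_imp_injective_map[OF assms]
    unfolding homeomorphic_maps_def continuous_map_def by (metis PiE inv_into_f_f)
  then have "continuous_map X X (inv_into (topspace X) f)"
    using g unfolding homeomorphic_maps_def by (metis continuous_map_eq)
  moreover have "continuous_map X X f"
    using g by (simp add: homeomorphic_maps_def)
  ultimately show ?thesis
    by (simp add: iter_def continuous_map_funpow)
qed

lemma iter_in_topspace:
  "\<lbrakk>homeomorphic_map X X f; p \<in> topspace X\<rbrakk> \<Longrightarrow> iter (topspace X) f i p \<in> topspace X"
  using continuous_map_iter[of X f i] by (auto simp: continuous_map_def)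

lemma iter_add_1:
  assumes "homeomorphic_map X X f" "p \<in> topspace X"
  shows "iter (topspace X) f (i + 1) p = f (iter (topspace X) f i p)"
proof (cases "0 \<le> i")
  case True
  then show ?thesis by (simp add: iter_def nat_add_distrib)
next
  case False
  let ?g = "inv_into (topspace X) f"
  have "nat (- i) = Suc (nat (- (i + 1)))" using False by linarith
  then have "iter (topspace X) f i p = ?g ((?g ^^ nat (- (i + 1))) p)"
    using False by (simp add: iter_def del: minus_add_distrib)
  moreover have "iter (topspace X) f (i + 1) p = (?g ^^ nat (- (i + 1))) p"
    using False by (cases "i = -1") (auto simp: iter_def)
  ultimately show ?thesis
    using iter_in_topspace[OF assms, of "i + 1"] homeomorphic_imp_surjective_map[OF assms(1)]
    by (metis f_inv_into_f)
qed

context Metric_space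
begin

lemma dyn_ball_sym: "q \<in> dyn_ball M d f a p \<Longrightarrow> p \<in> M \<Longrightarrow> p \<in> dyn_ball M d f a q"
  by (simp add: dyn_ball_def commute)

lemma dyn_ball_mono: "a \<le> b \<Longrightarrow> dyn_ball M d f a p \<subseteq> dyn_ball M d f b p"
  unfolding dyn_ball_def by (fastforce intro: order_trans)

lemma dyn_ball_trans:
  assumes "homeomorphic_map mtopology mtopology f" "p \<in> M"
    and "q \<in> dyn_ball M d f a p" "s \<in> dyn_ball M d f b q"
  shows "s \<in> dyn_ball M d f (a + b) p"
proof -
  have "d (iter M f i p) (iter M f i s) \<le> a + b" for i
  proof -
    have "iter M f i p \<in> M" "iter M f i q \<in> M" "iter M f i s \<in> M"
      using assms iter_in_topspace[OF assms(1)] by (auto simp: dyn_ball_def)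
    moreover have "d (iter M f i p) (iter M f i q) \<le> a" "d (iter M f i q) (iter M f i s) \<le> b"
      using assms(3,4) by (auto simp: dyn_ball_def)
    ultimately show ?thesis
      using triangle[of "iter M f i p" "iter M f i q" "iter M f i s"] by linarith
  qed
  then show ?thesis using assms(4) by (simp add: dyn_ball_def)
qed

section \<open>Continuous shadowing makes expansiveness descend\<close>

text \<open>The uniform continuity of \<open>f\<close> lets the error of a sequence be chosen independently at each
  time: every coordinate may be varied within a small ball around the true orbit. These are the
  pseudo-orbits to which continuity of the shadowing map is applied.\<close>

lemma near_orbit_in_delta_orbits:
  assumes "compact_space mtopology" "homeomorphic_map mtopology mtopology f" "0 < \<delta>"
  obtains e where "e > 0" "\<And>p x. \<lbrakk>p \<in> M; \<And>i. x i \<in> mball (iter M f i p) e\<rbrakk> \<Longrightarrow> x \<in> delta_orbits M d f \<delta>"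
proof -
  have fM: "continuous_map mtopology mtopology f"
    using assms(2) homeomorphic_imp_continuous_map by blast
  obtain \<eta> where "\<eta> > 0" and \<eta>: "\<And>x y. \<lbrakk>x \<in> M; y \<in> M; d x y < \<eta>\<rbrakk> \<Longrightarrow> d (f x) (f y) < \<delta> / 2"
    using compact_uniformly_continuous_self_map[OF assms(1) fM, of "\<delta> / 2"] \<open>0 < \<delta>\<close> by auto
  show thesis
  proof
    show "min \<eta> (\<delta> / 2) > 0" using \<open>\<eta> > 0\<close> \<open>0 < \<delta>\<close> by simp
    fix p and x :: "int \<Rightarrow> 'a"
    assume p: "p \<in> M" and x: "\<And>i. x i \<in> mball (iter M f i p) (min \<eta> (\<delta> / 2))"
    have xi: "iter M f i p \<in> M" "x i \<in> M" "d (iter M f i p) (x i) < \<eta>" "d (iter M f i p) (x i) < \<delta> / 2" for i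
      using x[of i] by auto
    have "d (x (i + 1)) (f (x i)) \<le> \<delta>" for i
    proof -
      have "f (x i) \<in> M" using fM xi(2) by (auto simp: continuous_map_def)
      moreover have "d (iter M f (i + 1) p) (f (x i)) < \<delta> / 2"
        using \<eta>[OF xi(1-3)[of i]] iter_add_1[OF assms(2), of p i] p by simp
      ultimately show ?thesis
        using xi[of "i + 1"] triangle[of "x (i + 1)" "iter M f (i + 1) p" "f (x i)"]
          commute[of "x (i + 1)" "iter M f (i + 1) p"] by linarith
    qed
    then show "x \<in> delta_orbits M d f \<delta>"
      using xi by (simp add: delta_orbits_def)
  qed
qed

text \<open>The map is \<open>h p = R (orbit of p)\<close>. It identifies \<open>p\<close> with \<open>q\<close> because both orbits lie in a
  product of small connected sets, on which \<open>R\<close> is constant: the values of \<open>R\<close> there form a connected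
  subset of a finite dynamical ball.\<close>

lemma T0_shadowing_collapse:
  assumes cm: "closed_manifold mtopology"
    and f: "homeomorphic_map mtopology mtopology f"
    and sh: "T0_continuous_shadowing mtopology d f"
    and "0 < \<epsilon>"
    and fin: "\<And>p. p \<in> M \<Longrightarrow> finite (dyn_ball M d f (2 * \<epsilon>) p)"
  obtains h \<eta> where "continuous_map mtopology mtopology h" "\<And>p. p \<in> M \<Longrightarrow> h p \<in> dyn_ball M d f \<epsilon> p"
    "0 < \<eta>" "\<And>p q. \<lbrakk>p \<in> M; q \<in> dyn_ball M d f \<eta> p\<rbrakk> \<Longrightarrow> h q = h p"
proof -
  let ?O = "\<lambda>p i. iter M f i p"
  have cpt: "compact_space mtopology"
    using cm by (auto simp: closed_manifold_def closed_manifold_of_dim_def)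
  obtain \<delta> R where "\<delta> > 0"
    and R: "continuous_map (subtopology (product_topology (\<lambda>_::int. mtopology) UNIV) (delta_orbits M d f \<delta>)) mtopology R"
    and shR: "\<And>x. x \<in> delta_orbits M d f \<delta> \<Longrightarrow> shadowed_by M d f \<epsilon> x (R x)"
    using sh \<open>0 < \<epsilon>\<close> unfolding T0_continuous_shadowing_def by (auto; metis)
  obtain e0 where "e0 > 0" and e0:
    "\<And>p x. \<lbrakk>p \<in> M; \<And>i. x i \<in> mball (iter M f i p) e0\<rbrakk> \<Longrightarrow> x \<in> delta_orbits M d f \<delta>"
    using near_orbit_in_delta_orbits[OF cpt f \<open>\<delta> > 0\<close>] by blast
  \<comment> \<open>Radius \<open>e0\<close> gives pseudo-orbits; radius \<open>\<epsilon>\<close> keeps the shadowing points, which are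
    \<open>\<epsilon>\<close>-close to the pseudo-orbit, within \<open>2 * \<epsilon>\<close> of the orbit of \<open>p\<close>.\<close>
  define e where "e = min e0 \<epsilon>"
  have "e > 0" using \<open>e0 > 0\<close> \<open>0 < \<epsilon>\<close> by (simp add: e_def)
  obtain \<eta> where "\<eta> > 0" and \<eta>: "\<And>x y. \<lbrakk>x \<in> M; y \<in> M; d x y < \<eta>\<rbrakk> \<Longrightarrow>
      \<exists>C. connectedin mtopology C \<and> x \<in> C \<and> y \<in> C \<and> C \<subseteq> mball x e"
    using small_connected_sets_join_close_points[OF cpt closed_manifold_locally_connected[OF cm] \<open>e > 0\<close>] by blast
  have O_M: "?O p i \<in> M" if "p \<in> M" for p i
    using iter_in_topspace[OF f, of p i] that by simp
  have O_orbit: "?O p \<in> delta_orbits M d f \<delta>" if "p \<in> M" for p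
    using e0[of p "?O p"] O_M that \<open>e0 > 0\<close> by simp
  show thesis
  proof
    show "continuous_map mtopology mtopology (\<lambda>p. R (?O p))"
    proof -
      have "continuous_map mtopology (product_topology (\<lambda>_::int. mtopology) UNIV) ?O"
        using continuous_map_iter[OF f] by (simp add: continuous_map_componentwise_UNIV)
      then have "continuous_map mtopology (subtopology (product_topology (\<lambda>_::int. mtopology) UNIV) (delta_orbits M d f \<delta>)) ?O"
        using O_orbit by (intro continuous_map_into_subtopology) auto
      from continuous_map_compose[OF this R] show ?thesis by (simp add: o_def)
    qed
    show "R (?O p) \<in> dyn_ball M d f \<epsilon> p" if "p \<in> M" for p
      using shR[OF O_orbit[OF that]] by (auto simp: shadowed_by_def dyn_ball_def commute)
    \<comment> \<open>Halving passes from the non-strict bounds of dynamical balls to the strict bound on \<open>\<eta>\<close>.\<close>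
    show "0 < \<eta> / 2" using \<open>\<eta> > 0\<close> by simp
    fix p q assume p: "p \<in> M" and q: "q \<in> dyn_ball M d f (\<eta> / 2) p"
    have "q \<in> M" "d (?O p i) (?O q i) < \<eta>" for i
      using q \<open>\<eta> > 0\<close> unfolding dyn_ball_def by (simp, smt (verit) field_sum_of_halves mem_Collect_eq)
    then have "\<forall>i. \<exists>C. connectedin mtopology C \<and> ?O p i \<in> C \<and> ?O q i \<in> C \<and> C \<subseteq> mball (?O p i) e"
      using \<eta> O_M p by simp
    then obtain C where C: "\<And>i. connectedin mtopology (C i)" "\<And>i. ?O p i \<in> C i" "\<And>i. ?O q i \<in> C i"
      "\<And>i. C i \<subseteq> mball (?O p i) e"
      by metis
    define S where "S = PiE UNIV C"
    have S: "x \<in> S \<longleftrightarrow> (\<forall>i. x i \<in> C i)" for x by (auto simp: S_def)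
    have near: "x i \<in> mball (?O p i) e" if "x \<in> S" for x i
      using C(4) S that by blast
    have S_orbit: "S \<subseteq> delta_orbits M d f \<delta>"
    proof
      fix x assume "x \<in> S"
      then show "x \<in> delta_orbits M d f \<delta>"
        using near by (intro e0[OF p]) (fastforce simp: e_def)
    qed
    have "connectedin (product_topology (\<lambda>_::int. mtopology) UNIV) S"
      unfolding S_def connectedin_PiE using C(1) by simp
    then have conn: "connectedin mtopology (R ` S)"
      using S_orbit by (intro connectedin_continuous_map_image[OF R]) (simp add: connectedin_subtopology)
    have "R ` S \<subseteq> dyn_ball M d f (2 * \<epsilon>) p"
    proof
      fix r assume "r \<in> R ` S"
      then obtain x where x: "x \<in> S" "r = R x" by blast
      then have r: "r \<in> M" "\<And>i. d (?O r i) (x i) \<le> \<epsilon>"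
        using shR S_orbit by (auto simp: shadowed_by_def)
      have "d (?O p i) (?O r i) \<le> 2 * \<epsilon>" for i
      proof -
        have "x i \<in> M" "d (?O p i) (x i) < \<epsilon>" using near[OF x(1), of i] by (auto simp: e_def)
        then show ?thesis
          using triangle[of "?O p i" "x i" "?O r i"] O_M p r commute[of "x i" "?O r i"]
          by (smt (verit, best))
      qed
      then show "r \<in> dyn_ball M d f (2 * \<epsilon>) p" using r by (simp add: dyn_ball_def)
    qed
    then have finRS: "finite (R ` S)" using fin[OF p] finite_subset by blast
    have "?O p \<in> S" "?O q \<in> S" using C S by auto
    \<comment> \<open>A connected set with at least two points has no isolated point, so it is not finite.\<close>
    have "\<exists>a. R ` S = {a}"
    proof (rule ccontr)
      assume "\<not> ?thesis"
      then have "R ` S \<subseteq> mtopology derived_set_of (R ` S)"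
        using conn connectedin_imp_perfect Hausdorff_space_mtopology by blast
      then show False
        using derived_set_of_finite[OF Hausdorff_space_mtopology finRS] \<open>?O p \<in> S\<close> by blast
    qed
    then show "R (?O q) = R (?O p)"
      using \<open>?O p \<in> S\<close> \<open>?O q \<in> S\<close> by (metis imageI singletonD)
  qed
qed

text \<open>Surjectivity provides every \<open>r\<close> in the ball of radius \<open>\<epsilon>\<close> with a preimage \<open>r'\<close>, which is in the
  ball of radius \<open>2 * \<epsilon>\<close> and hence, by the inclusion that is assumed, in the set on which \<open>h\<close> has the
  constant value \<open>h p\<close>. So \<open>r = h p\<close> for every such \<open>r\<close>, in particular for \<open>p\<close>.\<close>

lemma T0_shadowing_isolates:
  assumes cm: "closed_manifold mtopology"
    and f: "homeomorphic_map mtopology mtopology f"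
    and sh: "T0_continuous_shadowing mtopology d f"
    and surj: "\<And>h. \<lbrakk>continuous_map mtopology mtopology h; \<And>y. y \<in> M \<Longrightarrow> d y (h y) < e\<rbrakk> \<Longrightarrow> M \<subseteq> h ` M"
    and "0 < \<epsilon>" "\<epsilon> < e"
    and fin: "\<And>p. p \<in> M \<Longrightarrow> finite (dyn_ball M d f (2 * \<epsilon>) p)"
  obtains \<eta> where "0 < \<eta>"
    "\<And>p. \<lbrakk>p \<in> M; dyn_ball M d f (2 * \<epsilon>) p \<subseteq> dyn_ball M d f \<eta> p\<rbrakk> \<Longrightarrow> dyn_ball M d f \<epsilon> p = {p}"
proof -
  obtain h \<eta> where h: "continuous_map mtopology mtopology h" "\<And>p. p \<in> M \<Longrightarrow> h p \<in> dyn_ball M d f \<epsilon> p"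
    and "0 < \<eta>" and const: "\<And>p q. \<lbrakk>p \<in> M; q \<in> dyn_ball M d f \<eta> p\<rbrakk> \<Longrightarrow> h q = h p"
    using T0_shadowing_collapse[OF cm f sh \<open>0 < \<epsilon>\<close> fin] by blast
  have "d y (h y) < e" if "y \<in> M" for y
  proof -
    have "d (iter M f 0 y) (iter M f 0 (h y)) \<le> \<epsilon>"
      using h(2)[OF that] unfolding dyn_ball_def by blast
    then show ?thesis using \<open>\<epsilon> < e\<close> by simp
  qed
  then have onto: "M \<subseteq> h ` M" using surj h(1) by blast
  have "q = p" if p: "p \<in> M" and sub: "dyn_ball M d f (2 * \<epsilon>) p \<subseteq> dyn_ball M d f \<eta> p"
    and q: "q \<in> dyn_ball M d f \<epsilon> p" for p q
  proof -
    have "r = h p" if r: "r \<in> dyn_ball M d f \<epsilon> p" for r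
    proof -
      have "r \<in> M" using r by (simp add: dyn_ball_def)
      then obtain r' where r': "r' \<in> M" "r = h r'" using onto by blast
      then have "r' \<in> dyn_ball M d f \<epsilon> r"
        using h(2) dyn_ball_sym by blast
      then have "r' \<in> dyn_ball M d f (2 * \<epsilon>) p"
        using dyn_ball_trans[OF f p r, of r' \<epsilon>] by simp
      then show ?thesis using sub const[OF p] r'(2) by blast
    qed
    moreover have "p \<in> dyn_ball M d f \<epsilon> p"
      using p iter_in_topspace[OF f, of p] \<open>0 < \<epsilon>\<close> by (simp add: dyn_ball_def)
    ultimately show ?thesis using q by metis
  qed
  moreover have "p \<in> dyn_ball M d f \<epsilon> p" if "p \<in> M" for p
    using that iter_in_topspace[OF f, of p] \<open>0 < \<epsilon>\<close> by (simp add: dyn_ball_def)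
  ultimately show thesis
    using that[OF \<open>0 < \<eta>\<close>] by blast
qed

text \<open>Compare the balls of radius \<open>2 * \<epsilon>\<close> and \<open>\<eta>\<close> around a point: if the first is contained in the
  second, the ball of radius \<open>\<epsilon>\<close> is a point, which is where \<open>1 \<le> N\<close> enters; if not, the ball of radius
  \<open>min \<epsilon> \<eta>\<close> misses one of the at most \<open>N + 1\<close> points of the first.\<close>

lemma N_expansive_Suc_imp_N_expansive:
  assumes cm: "closed_manifold mtopology"
    and f: "homeomorphic_map mtopology mtopology f"
    and sh: "T0_continuous_shadowing mtopology d f"
    and "1 \<le> N" and exp: "N_expansive (Suc N) M d f"
  shows "N_expansive N M d f"
proof -
  obtain e where "e > 0" and
    e: "\<And>h. \<lbrakk>continuous_map mtopology mtopology h; \<And>y. y \<in> M \<Longrightarrow> d y (h y) < e\<rbrakk> \<Longrightarrow> M \<subseteq> h ` M"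
    using near_identity_surjective[OF cm] by blast
  obtain \<xi> where "\<xi> > 0" and \<xi>: "\<And>p. p \<in> M \<Longrightarrow> finite (dyn_ball M d f \<xi> p)"
    "\<And>p. p \<in> M \<Longrightarrow> card (dyn_ball M d f \<xi> p) \<le> Suc N"
    using exp unfolding N_expansive_def by blast
  define \<epsilon> where "\<epsilon> = min (e / 2) (\<xi> / 2)"
  have \<epsilon>: "0 < \<epsilon>" "\<epsilon> < e" "2 * \<epsilon> \<le> \<xi>" using \<open>e > 0\<close> \<open>\<xi> > 0\<close> by (auto simp: \<epsilon>_def)
  have fin: "finite (dyn_ball M d f (2 * \<epsilon>) p)" "card (dyn_ball M d f (2 * \<epsilon>) p) \<le> Suc N"
    if "p \<in> M" for p
    using \<xi>[OF that] dyn_ball_mono[OF \<epsilon>(3), of f p] finite_subset card_mono le_trans by metis+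
  obtain \<eta> where "0 < \<eta>" and \<eta>:
    "\<And>p. \<lbrakk>p \<in> M; dyn_ball M d f (2 * \<epsilon>) p \<subseteq> dyn_ball M d f \<eta> p\<rbrakk> \<Longrightarrow> dyn_ball M d f \<epsilon> p = {p}"
    using T0_shadowing_isolates[OF cm f sh e \<epsilon>(1,2) fin(1)] by blast
  have "finite (dyn_ball M d f (min \<epsilon> \<eta>) p) \<and> card (dyn_ball M d f (min \<epsilon> \<eta>) p) \<le> N"
    if p: "p \<in> M" for p
  proof (cases "dyn_ball M d f (2 * \<epsilon>) p \<subseteq> dyn_ball M d f \<eta> p")
    case True
    then have "dyn_ball M d f (min \<epsilon> \<eta>) p \<subseteq> {p}"
      using \<eta>[OF p] dyn_ball_mono[of "min \<epsilon> \<eta>" \<epsilon> f p] by simp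
    then show ?thesis
      using \<open>1 \<le> N\<close> by (auto dest!: subset_singletonD)
  next
    case False
    have "dyn_ball M d f (min \<epsilon> \<eta>) p \<subseteq> dyn_ball M d f (2 * \<epsilon>) p"
      "dyn_ball M d f (min \<epsilon> \<eta>) p \<subseteq> dyn_ball M d f \<eta> p"
      using \<epsilon>(1) by (intro dyn_ball_mono; simp)+
    then have "dyn_ball M d f (min \<epsilon> \<eta>) p \<subset> dyn_ball M d f (2 * \<epsilon>) p"
      using False by blast
    then show ?thesis
      using fin[OF p] psubset_card_mono[OF fin(1)[OF p]]
      by (meson finite_subset less_Suc_eq_le less_le_trans psubset_imp_subset)
  qed
  then show ?thesis
    unfolding N_expansive_def using \<epsilon>(1) \<open>0 < \<eta>\<close> by (intro exI[of _ "min \<epsilon> \<eta>"]) simp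
qed

lemma expansive_if_1_expansive:
  assumes f: "homeomorphic_map mtopology mtopology f" and "N_expansive 1 M d f"
  shows "expansive M d f"
proof -
  obtain \<xi> where "\<xi> > 0" and \<xi>: "\<And>p. p \<in> M \<Longrightarrow> finite (dyn_ball M d f \<xi> p)"
    "\<And>p. p \<in> M \<Longrightarrow> card (dyn_ball M d f \<xi> p) \<le> 1"
    using assms(2) unfolding N_expansive_def by blast
  have "\<exists>i. d (iter M f i p) (iter M f i q) > \<xi>" if "p \<in> M" "q \<in> M" "p \<noteq> q" for p q
  proof (rule ccontr)
    assume "\<not> ?thesis"
    then have "{p, q} \<subseteq> dyn_ball M d f \<xi> p"
      using that iter_in_topspace[OF f, of p] \<open>\<xi> > 0\<close> by (auto simp: dyn_ball_def not_less)
    then show False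
      using card_mono[OF \<xi>(1)[OF that(1)], of "{p, q}"] \<xi>(2)[OF that(1)] that(3) by simp
  qed
  then show ?thesis unfolding expansive_def using \<open>\<xi> > 0\<close> by blast
qed

end

theorem theorem8p6:
  fixes X :: "'a topology" and d :: "'a \<Rightarrow> 'a \<Rightarrow> real" and f :: "'a \<Rightarrow> 'a" and N :: nat
  assumes "closed_manifold X"
    and "Metric_space (topspace X) d"
    and "Metric_space.mtopology (topspace X) d = X"
    and "homeomorphic_map X X f"
    and "N \<ge> 1"
    and "N_expansive N (topspace X) d f"
    and "T0_continuous_shadowing X d f"
  shows "topologically_hyperbolic (topspace X) d f"
proof -
  interpret Metric_space "topspace X" d by fact
  note X = assms(3)
  have "N_expansive 1 (topspace X) d f"
    using assms(5,6)
  proof (induction N rule: dec_induct)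
    case (step n)
    then show ?case
      using N_expansive_Suc_imp_N_expansive[of f n] assms(1,4,7) by (simp add: X)
  qed
  then have "expansive (topspace X) d f"
    using expansive_if_1_expansive[of f] assms(4) by (simp add: X)
  moreover have "has_shadowing (topspace X) d f"
    using assms(7) unfolding T0_continuous_shadowing_def has_shadowing_def by meson
  ultimately show ?thesis
    by (simp add: topologically_hyperbolic_def)
qed

end
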